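(* Let $\mathbb{O}$ be the real octonion division algebra (Cayley's octonions). Then every matrix $A\in M_2(\mathbb{O})$ admits a right eigenvalue, i.e. there exist $\lambda\in\mathbb{O}$ and a nonzero vector $\vec v\in\mathbb{O}^2$ such that $A\vec v=\vec v\lambda$.
   Context: For $A=(a_{ij})\in M_2(\mathbb{O})$ and $\vec v=(v_1,v_2)^T\in\mathbb{O}^2$, the column vector $A\vec v$ has $i$-th entry $a_{i1}v_1+a_{i2}v_2$, and $\vec v\lambda$ has $i$-th entry $v_i\lambda$. An element $\lambda\in\mathbb{O}$ is a right eigenvalue of $A$ if $A\vec v=\vec v\lambda$ for some nonzero $\vec v$. *)

theory Defs
  imports "HOL-Analysis.Analysis"
begin

text \<open>
  Two Cayley--Dickson doublings of \<^typ>\<open>complex\<close> give the quaternions and the octonions; both use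
  the convention \<open>(a, b) (c, d) = (a c - d\<^sup>* b, d a + b c\<^sup>*)\<close> and \<open>(a, b)\<^sup>* = (a\<^sup>*, - b)\<close>.
\<close>

datatype quat = Quat (q1: complex) (q2: complex)

lemma quat_eq_iff: "x = y \<longleftrightarrow> q1 x = q1 y \<and> q2 x = q2 y" for x y :: quat
  by (cases x; cases y) auto

instantiation quat :: "{real_vector, one, times}"
begin

definition "0 = Quat 0 0"
definition "1 = Quat 1 0"
definition "x + y = Quat (q1 x + q1 y) (q2 x + q2 y)"
definition "x - y = Quat (q1 x - q1 y) (q2 x - q2 y)"
definition "- x = Quat (- q1 x) (- q2 x)"
definition "r *\<^sub>R x = Quat (r *\<^sub>R q1 x) (r *\<^sub>R q2 x)"
definition "x * y = Quat (q1 x * q1 y - cnj (q2 y) * q2 x) (q2 y * q1 x + q2 x * cnj (q1 y))"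

instance
  by standard
    (auto simp: zero_quat_def plus_quat_def minus_quat_def uminus_quat_def scaleR_quat_def
      algebra_simps)

end

definition quat_cnj :: "quat \<Rightarrow> quat" where
  "quat_cnj x = Quat (cnj (q1 x)) (- q2 x)"

datatype octonion = Oct (o1: quat) (o2: quat)

lemma octonion_eq_iff: "x = y \<longleftrightarrow> o1 x = o1 y \<and> o2 x = o2 y" for x y :: octonion
  by (cases x; cases y) auto

instantiation octonion :: "{real_vector, one, times}"
begin

definition "0 = Oct 0 0"
definition "1 = Oct 1 0"
definition "x + y = Oct (o1 x + o1 y) (o2 x + o2 y)"
definition "x - y = Oct (o1 x - o1 y) (o2 x - o2 y)"
definition "- x = Oct (- o1 x) (- o2 x)"
definition "r *\<^sub>R x = Oct (r *\<^sub>R o1 x) (r *\<^sub>R o2 x)"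
definition "x * y =
  Oct (o1 x * o1 y - quat_cnj (o2 y) * o2 x) (o2 y * o1 x + o2 x * quat_cnj (o1 y))"

instance
  by standard
    (auto simp: zero_octonion_def plus_octonion_def minus_octonion_def uminus_octonion_def
      scaleR_octonion_def algebra_simps)

end

lemmas quat_defs = zero_quat_def one_quat_def plus_quat_def minus_quat_def uminus_quat_def
  scaleR_quat_def times_quat_def quat_cnj_def

lemmas octonion_defs = zero_octonion_def one_octonion_def plus_octonion_def minus_octonion_def
  uminus_octonion_def scaleR_octonion_def times_octonion_def

text \<open>
  The product is bilinear, unital, alternative, not associative, and admits division by nonzero
  elements on either side: \<^typ>\<open>octonion\<close> is an alternative, nonassociative real division algebra.
\<close>

lemma bilinear_octonion_times: "bilinear ((*) :: octonion \<Rightarrow> _)"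
  unfolding bilinear_def
  by (auto intro!: linearI simp: octonion_defs quat_defs algebra_simps)

lemma octonion_one_mult: "1 * x = x" "x * 1 = x" for x :: octonion
  by (cases x; cases "o1 x"; cases "o2 x"; simp add: octonion_defs quat_defs)+

lemma octonion_alternative:
  "x * (x * y) = (x * x) * y" "(y * x) * x = y * (x * x)" for x y :: octonion
  by (auto simp: octonion_defs quat_defs complex_eq_iff; algebra)+

lemma octonion_not_associative: "\<exists>x y z :: octonion. (x * y) * z \<noteq> x * (y * z)"
  by (rule exI[of _ "Oct (Quat \<i> 0) 0"], rule exI[of _ "Oct (Quat 0 1) 0"],
      rule exI[of _ "Oct 0 1"])
    (simp add: octonion_defs quat_defs complex_eq_iff)

definition octonion_cnj :: "octonion \<Rightarrow> octonion" where
  "octonion_cnj x = Oct (quat_cnj (o1 x)) (- o2 x)"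

definition octonion_normsq :: "octonion \<Rightarrow> real" where
  "octonion_normsq x =
    (cmod (q1 (o1 x)))\<^sup>2 + (cmod (q2 (o1 x)))\<^sup>2 + (cmod (q1 (o2 x)))\<^sup>2 + (cmod (q2 (o2 x)))\<^sup>2"

lemma octonion_normsq_eq_0_iff: "octonion_normsq x = 0 \<longleftrightarrow> x = 0"
  by (auto simp: octonion_normsq_def octonion_eq_iff quat_eq_iff zero_octonion_def zero_quat_def
      add_nonneg_eq_0_iff)

lemma octonion_cnj_cancel:
  "octonion_cnj x * (x * y) = octonion_normsq x *\<^sub>R y"
  "(y * x) * octonion_cnj x = octonion_normsq x *\<^sub>R y"
  by (auto simp: octonion_defs quat_defs octonion_cnj_def octonion_normsq_def cmod_power2
      octonion_eq_iff quat_eq_iff complex_eq_iff; algebra)+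

lemma octonion_cnj_cancel':
  "x * (octonion_cnj x * y) = octonion_normsq x *\<^sub>R y"
  "(y * octonion_cnj x) * x = octonion_normsq x *\<^sub>R y"
  by (auto simp: octonion_defs quat_defs octonion_cnj_def octonion_normsq_def cmod_power2
      octonion_eq_iff quat_eq_iff complex_eq_iff; algebra)+

lemma octonion_scaleR_mult:
  "(r *\<^sub>R x) * y = r *\<^sub>R (x * y)" "x * (r *\<^sub>R y) = r *\<^sub>R (x * y)" for x y :: octonion
  by (auto simp: octonion_defs quat_defs algebra_simps)

lemma octonion_division:
  assumes "a \<noteq> (0 :: octonion)"
  shows "\<exists>!x. a * x = b" "\<exists>!x. x * a = b"
proof -
  let ?n = "octonion_normsq a" and ?c = "octonion_cnj a"
  have n: "?n \<noteq> 0"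
    using assms by (simp add: octonion_normsq_eq_0_iff)
  show "\<exists>!x. a * x = b"
  proof
    show "a * (inverse ?n *\<^sub>R (?c * b)) = b"
      using n by (simp add: octonion_scaleR_mult octonion_cnj_cancel')
    show "x = inverse ?n *\<^sub>R (?c * b)" if "a * x = b" for x
      using n by (simp add: that[symmetric] octonion_cnj_cancel)
  qed
  show "\<exists>!x. x * a = b"
  proof
    show "(inverse ?n *\<^sub>R (b * ?c)) * a = b"
      using n by (simp add: octonion_scaleR_mult octonion_cnj_cancel')
    show "x = inverse ?n *\<^sub>R (b * ?c)" if "x * a = b" for x
      using n by (simp add: that[symmetric] octonion_cnj_cancel)
  qed
qed

text \<open>
  The library product \<^term>\<open>(*v)\<close> requires an associative coefficient ring, so it does not apply here.
\<close>

definition oct_matrix_vector_mult :: "octonion ^ 2 ^ 2 \<Rightarrow> octonion ^ 2 \<Rightarrow> octonion ^ 2" where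
  "oct_matrix_vector_mult A v = (\<chi> i. A $ i $ 1 * v $ 1 + A $ i $ 2 * v $ 2)"

definition oct_vector_scale_right :: "octonion ^ 2 \<Rightarrow> octonion \<Rightarrow> octonion ^ 2" where
  "oct_vector_scale_right v l = (\<chi> i. v $ i * l)"

definition right_eigenvalue :: "octonion ^ 2 ^ 2 \<Rightarrow> octonion \<Rightarrow> bool" where
  "right_eigenvalue A l \<longleftrightarrow>
    (\<exists>v. v \<noteq> 0 \<and> oct_matrix_vector_mult A v = oct_vector_scale_right v l)"

end

theory Submission
  imports Defs "HOL-Library.Quadratic_Discriminant"
begin

text \<open>
  If \<open>b = A\<^sub>1\<^sub>2 = 0\<close>, then \<open>(0, 1)\<close> is an eigenvector. Otherwise one looks for an eigenvector \<open>(1, y)\<close>,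
  i.e. a solution of \<open>y (a + b y) = c + d y\<close>; with \<open>w = b y\<close>, the right alternative law turns this into
  \<open>w\<^sup>2 + L w = e\<close> for a real-linear \<open>L\<close>. Splitting \<open>w = r + u\<close> into real and imaginary part, one has
  \<open>w\<^sup>2 = r\<^sup>2 - |u|\<^sup>2 + 2 r u\<close>, so the imaginary part of the equation is a linear system
  \<open>(M + 2 r) u = c + r p\<close> on \<open>\<real>\<^sup>7\<close>, and the real part is one scalar equation in \<open>r\<close> and \<open>u\<close>.
  As 7 is odd, there is a largest \<open>r\<^sub>0\<close> for which \<open>M + 2 r\<^sub>0\<close> is singular. For \<open>r > r\<^sub>0\<close> the system has
  a unique solution \<open>u(r)\<close>, bounded as \<open>r \<rightarrow> \<infinity>\<close>, so the difference \<open>g\<close> of the two sides of the scalar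
  equation is eventually positive there. If \<open>g \<le> 0\<close> for some \<open>r > r\<^sub>0\<close>, the intermediate value theorem
  applies. If not, \<open>u(r)\<close> stays bounded as \<open>r \<rightarrow> r\<^sub>0\<close> and accumulates at a solution for \<open>r\<^sub>0\<close> with
  \<open>g \<ge> 0\<close>; moving from it along the kernel of \<open>M + 2 r\<^sub>0\<close> sends \<open>g\<close> to \<open>-\<infinity>\<close> and hence through 0.
\<close>

section \<open>Real coordinates on the imaginary octonions\<close>

lemma exhaust_7:
  fixes x :: 7
  shows "x = 1 \<or> x = 2 \<or> x = 3 \<or> x = 4 \<or> x = 5 \<or> x = 6 \<or> x = 7"
proof (induct x)
  case (of_int z)
  then have "0 \<le> z" "z < 7" by simp_all
  then have "z = 0 \<or> z = 1 \<or> z = 2 \<or> z = 3 \<or> z = 4 \<or> z = 5 \<or> z = 6" by arith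
  then show ?case by auto
qed

lemma UNIV_7: "UNIV = {1, 2, 3, 4, 5, 6, 7 :: 7}"
  using exhaust_7 by auto

lemma sum_7: "sum f (UNIV :: 7 set) = f 1 + f 2 + f 3 + f 4 + f 5 + f 6 + f 7"
  unfolding UNIV_7 by (simp add: ac_simps)

text \<open>Coordinates in \<open>real ^ 7\<close> make matrices and determinants available for the
  imaginary part of the equation.\<close>

definition oct_im :: "real ^ 7 \<Rightarrow> octonion" where
  "oct_im u = Oct (Quat (Complex 0 (u $ 1)) (Complex (u $ 2) (u $ 3)))
    (Quat (Complex (u $ 4) (u $ 5)) (Complex (u $ 6) (u $ 7)))"

definition oct_vec :: "octonion \<Rightarrow> real ^ 7" where
  "oct_vec x = (\<chi> i. if i = 1 then Im (q1 (o1 x)) else if i = 2 then Re (q2 (o1 x))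
    else if i = 3 then Im (q2 (o1 x)) else if i = 4 then Re (q1 (o2 x))
    else if i = 5 then Im (q1 (o2 x)) else if i = 6 then Re (q2 (o2 x)) else Im (q2 (o2 x)))"

lemma linear_oct_im: "linear oct_im"
  by (rule linearI) (simp_all add: oct_im_def octonion_defs quat_defs complex_eq_iff)

lemma linear_oct_vec: "linear oct_vec"
  by (rule linearI) (simp_all add: oct_vec_def octonion_defs quat_defs vec_eq_iff)

abbreviation oct_re :: "octonion \<Rightarrow> real" where
  "oct_re x \<equiv> Re (q1 (o1 x))"

lemma linear_oct_re: "linear oct_re"
  by (rule linearI) (simp_all add: octonion_defs quat_defs)

lemma oct_eqI:
  assumes "oct_re x = oct_re y" "oct_vec x = oct_vec y"
  shows "x = y"
proof -
  have "oct_vec x $ i = oct_vec y $ i" for i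
    using assms by simp
  from this[of 1] this[of 2] this[of 3] this[of 4] this[of 5] this[of 6] this[of 7] assms(1)
  show ?thesis
    by (simp add: oct_vec_def octonion_eq_iff quat_eq_iff complex_eq_iff)
qed

lemma oct_vec_im [simp]: "oct_vec (oct_im u) = u"
proof -
  have "oct_vec (oct_im u) $ i = u $ i" for i
    using exhaust_7[of i] by (auto simp: oct_vec_def oct_im_def)
  then show ?thesis
    by (simp add: vec_eq_iff)
qed

lemma oct_re_im [simp]: "oct_re (oct_im u) = 0"
  by (simp add: oct_im_def)

lemma oct_re_one [simp]: "oct_re 1 = 1"
  and oct_vec_one [simp]: "oct_vec 1 = 0"
  by (simp_all add: oct_vec_def octonion_defs quat_defs vec_eq_iff)

text \<open>Real multiples of 1 commute with everything, and an imaginary octonion squares to minus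
  its squared norm.\<close>

lemma oct_square:
  "(r *\<^sub>R 1 + oct_im u) * (r *\<^sub>R 1 + oct_im u) = (r\<^sup>2 - u \<bullet> u) *\<^sub>R 1 + (2 * r) *\<^sub>R oct_im u"
  by (simp add: oct_im_def octonion_defs quat_defs complex_eq_iff inner_vec_def sum_7
      power2_eq_square algebra_simps)

section \<open>Determinants of a real matrix shifted by a scalar\<close>

lemma continuous_on_det:
  fixes F :: "'a::topological_space \<Rightarrow> real ^ 'n ^ 'n"
  assumes "\<And>i j. continuous_on S (\<lambda>x. F x $ i $ j)"
  shows "continuous_on S (\<lambda>x. det (F x))"
  unfolding det_def by (intro continuous_intros assms)

lemma continuous_on_mat [continuous_intros]:
  fixes f :: "'a::topological_space \<Rightarrow> real"
  assumes "continuous_on S f"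
  shows "continuous_on S (\<lambda>x. mat (f x) :: real ^ 'n ^ 'n)"
proof -
  have "continuous_on S (\<lambda>x. if i = j then f x else 0)" for i j :: 'n
    using assms by (cases "i = j") simp_all
  then show ?thesis
    unfolding mat_def by (intro continuous_on_vec_lambda)
qed

lemma mat_mult_vec: "mat r *v u = r *\<^sub>R u" for u :: "real ^ 'n"
  by (simp add: vec_eq_iff matrix_vector_mult_def mat_def if_distrib[of "\<lambda>x. x * _"] cong: if_cong)

lemma det_eq_0_iff_kernel: "det A = 0 \<longleftrightarrow> (\<exists>x. x \<noteq> 0 \<and> A *v x = 0)" for A :: "real ^ 'n ^ 'n"
  using invertible_det_nz[of A] matrix_left_invertible_ker[of A] invertible_left_inverse[of A]
  by blast

lemma det_uminus: "det (- A) = (- 1) ^ CARD('n) * det A" for A :: "real ^ 'n ^ 'n"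
proof -
  have "- A = (\<chi> i. (- 1) *s A $ i)"
    by (simp add: vec_eq_iff)
  then show ?thesis
    using det_rows_mul[of "\<lambda>_. - 1" "\<lambda>i. A $ i"] by simp
qed

text \<open>Deform \<open>mat r\<close> to \<open>A + mat r\<close> through
  \<open>t *\<^sub>R A + mat r\<close>. A kernel vector \<open>x\<close> on the way would satisfy
  \<open>r * norm x = t * norm (A *v x)\<close>, which is too small, so the determinant keeps its
  sign.\<close>

lemma det_shift_pos:
  fixes A :: "real ^ 'n ^ 'n"
  assumes "onorm ((*v) A) < r"
  shows "det (A + mat r) > 0"
proof (rule ccontr)
  define D where "D t = det (t *\<^sub>R A + mat r)" for t :: real
  have r: "r > 0"
    using assms onorm_pos_le[OF matrix_vector_mul_bounded_linear, of A] by linarith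
  assume "\<not> det (A + mat r) > 0"
  then have "D 1 \<le> 0"
    by (simp add: D_def)
  moreover have "D 0 \<ge> 0"
    using r by (simp add: D_def det_diagonal mat_def prod_nonneg)
  moreover have "continuous_on {0..1} D"
    unfolding D_def by (intro continuous_on_det continuous_intros)
  ultimately obtain t where t: "0 \<le> t" "t \<le> 1" "D t = 0"
    using IVT2'[of D 1 0 0] by auto
  then obtain x where x: "x \<noteq> 0" "(t *\<^sub>R A + mat r) *v x = 0"
    unfolding D_def det_eq_0_iff_kernel by blast
  then have "r *\<^sub>R x = - (t *\<^sub>R (A *v x))"
    by (simp add: matrix_vector_mult_add_rdistrib mat_mult_vec scaleR_matrix_vector_assoc
        add_eq_0_iff)
  then have "norm (r *\<^sub>R x) = norm (t *\<^sub>R (A *v x))"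
    by simp
  then have "r * norm x = t * norm (A *v x)"
    using r t by simp
  also have "\<dots> \<le> norm (A *v x)"
    using t by (simp add: mult_left_le_one_le)
  also have "\<dots> \<le> onorm ((*v) A) * norm x"
    by (rule onorm) simp
  also have "\<dots> < r * norm x"
    using assms x by simp
  finally show False by simp
qed

text \<open>In odd dimension \<open>det (A + mat r)\<close> is positive for large \<open>r\<close>
  and negative for very negative \<open>r\<close>, so its zeros in \<open>{-R..R}\<close> form a
  nonempty compact set. Beyond the largest one, a nonpositive value would force a further
  zero.\<close>

lemma odd_largest_singular_shift:
  fixes A :: "real ^ 'n ^ 'n"
  assumes "odd CARD('n)"
  obtains s where "det (A + mat s) = 0" "\<And>r. r > s \<Longrightarrow> det (A + mat r) > 0"
proof -
  define D where "D r = det (A + mat r)" for r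
  define R where "R = max (onorm ((*v) A)) (onorm ((*v) (- A))) + 1"
  have cont: "continuous_on X D" for X
    unfolding D_def by (intro continuous_on_det continuous_intros)
  have pos: "D r > 0" if "r \<ge> R" for r
    using that unfolding D_def R_def by (intro det_shift_pos) auto
  have "det (- A + mat R) > 0"
    unfolding R_def by (rule det_shift_pos) auto
  moreover have "A + mat (- R) = - (- A + mat R)"
    by (simp add: vec_eq_iff mat_def)
  ultimately have neg: "D (- R) < 0"
    unfolding D_def using assms by (simp only: det_uminus) simp
  have "R \<ge> 0"
    using onorm_pos_le[OF matrix_vector_mul_bounded_linear, of A] unfolding R_def by linarith
  define Z where "Z = {-R..R} \<inter> D -` {0}"
  have "\<exists>x\<ge>-R. x \<le> R \<and> D x = 0"
    using \<open>R \<ge> 0\<close> neg pos[of R] cont by (intro IVT') auto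
  then have "Z \<noteq> {}"
    by (auto simp: Z_def)
  moreover have "compact Z"
    unfolding Z_def compact_eq_bounded_closed
    by (auto intro: continuous_closed_preimage[OF cont] bounded_subset[OF bounded_closed_interval])
  ultimately obtain s where s: "s \<in> Z" "\<And>t. t \<in> Z \<Longrightarrow> t \<le> s"
    using compact_attains_sup by metis
  show ?thesis
  proof
    show "det (A + mat s) = 0"
      using s(1) by (simp add: Z_def D_def)
    show "det (A + mat r) > 0" if "r > s" for r
    proof (rule ccontr)
      assume "\<not> det (A + mat r) > 0"
      then have "D r \<le> 0" "r < R"
        using pos[of r] by (auto simp: D_def not_less intro: leI)
      then obtain t where "r \<le> t" "t \<le> R" "D t = 0"
        using IVT'[of D r 0 R] pos[of R] cont by auto
      then show False
        using s(1) s(2)[of t] that by (simp add: Z_def)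
    qed
  qed
qed


section \<open>A singular family of linear systems coupled with a scalar quadratic\<close>

text \<open>This is the imaginary and the real part of \<open>w * w + L w = e\<close>:
  \<open>A\<close> and \<open>q\<close> encode \<open>L\<close> on imaginary octonions, while
  \<open>- p\<close> and \<open>a\<close> are the two parts of \<open>L 1\<close>.\<close>

lemma odd_shifted_system_with_quadratic:
  fixes A :: "real ^ 'n ^ 'n" and c p q :: "real ^ 'n" and a e :: real
  assumes "odd CARD('n)"
  obtains r u where "A *v u + (2 * r) *\<^sub>R u = c + r *\<^sub>R p" "r\<^sup>2 - u \<bullet> u + a * r + q \<bullet> u = e"
proof -
  note solution = that
  define B where "B r = A + mat (2 * r)" for r
  define g where "g r u = r\<^sup>2 - u \<bullet> u + a * r + q \<bullet> u - e" for r :: real and u :: "real ^ 'n"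
  obtain s where s: "det (A + mat s) = 0" "\<And>r. r > s \<Longrightarrow> det (A + mat r) > 0"
    using odd_largest_singular_shift[OF assms, of A] by metis
  define r0 where "r0 = s / 2"
  have r0: "det (B r0) = 0"
    using s(1) by (simp add: B_def r0_def)
  have det_pos: "det (B r) > 0" if "r > r0" for r
    using s(2)[of "2 * r"] that by (simp add: B_def r0_def)
  \<comment> \<open>Cramer's rule, written out so that continuity in \<open>r\<close> can be read
    off the formula.\<close>
  define U where "U r =
    (\<chi> k. det (\<chi> i j. if j = k then (c + r *\<^sub>R p) $ i else B r $ i $ j) / det (B r))" for r
  have B_mult: "B r *v u = A *v u + (2 * r) *\<^sub>R u" for r u
    by (simp add: B_def matrix_vector_mult_add_rdistrib mat_mult_vec)
  have U: "B r *v U r = c + r *\<^sub>R p" if "r > r0" for r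
    using cramer[of "B r" "U r" "c + r *\<^sub>R p"] det_pos[OF that] unfolding U_def by auto
  have *: thesis if "B r *v u = c + r *\<^sub>R p" "g r u = 0" for r u
    using that by (intro solution) (auto simp: B_mult g_def)
  have cont_U: "continuous_on {r0<..} U"
  proof -
    have entry: "continuous_on {r0<..} (\<lambda>r. if j = k then (c + r *\<^sub>R p) $ i else B r $ i $ j)"
      for i j k
      unfolding B_def by (cases "j = k")
        (auto simp del: vector_add_component intro!: continuous_intros)
    have "continuous_on {r0<..} (\<lambda>r. det (B r))"
      unfolding B_def by (intro continuous_on_det continuous_intros)
    then show ?thesis
      unfolding U_def using det_pos
      by (intro continuous_on_vec_lambda continuous_on_divide[OF continuous_on_det])
        (auto intro: entry simp: less_imp_neq[symmetric])
  qed
  have cont_g: "continuous_on {r0<..} (\<lambda>r. g r (U r))"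
    unfolding g_def by (intro continuous_intros cont_U)
  show thesis
  proof (cases "\<exists>r>r0. g r (U r) \<le> 0")
    case True
    then obtain r1 where r1: "r1 > r0" "g r1 (U r1) \<le> 0" by blast
    define K where "K = onorm ((*v) A)"
    define M where "M = norm c + norm p"
    define D where "D = M\<^sup>2 + norm q * M + \<bar>e\<bar>"
    \<comment> \<open>\<open>R \<ge> K\<close> lets half of \<open>2 * R * norm u\<close> absorb
      \<open>A *v u\<close>, which gives \<open>norm u \<le> M\<close>. The last entry makes the
      square of \<open>R\<close> outweigh the remaining terms of \<open>g\<close>, which are at
      least \<open>- \<bar>a\<bar> * R - D\<close>.\<close>
    define R where "R = Max {r1, K, \<bar>a\<bar> + D + 1}"
    have R: "R \<ge> r1" "R \<ge> K" "R \<ge> \<bar>a\<bar> + D + 1"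
      by (auto simp: R_def)
    have "M \<ge> 0" "D \<ge> 0"
      by (simp_all add: M_def D_def)
    have "R \<ge> 1"
      using R \<open>D \<ge> 0\<close> by linarith
    define u where "u = U R"
    have "(2 * R) *\<^sub>R u = c + R *\<^sub>R p - A *v u"
      using U[of R] R r1 by (simp add: u_def B_mult algebra_simps)
    then have "2 * R * norm u = norm (c + R *\<^sub>R p - A *v u)"
      using \<open>R \<ge> 1\<close>
      by (metis abs_of_nonneg norm_scaleR mult_nonneg_nonneg order_trans zero_le_numeral zero_le_one)
    also have "\<dots> \<le> norm c + R * norm p + norm (A *v u)"
      using norm_triangle_ineq4[of "c + R *\<^sub>R p" "A *v u"] norm_triangle_ineq[of c "R *\<^sub>R p"] \<open>R \<ge> 1\<close>
      by simp
    also have "norm (A *v u) \<le> K * norm u"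
      unfolding K_def by (rule onorm) simp
    also have "\<dots> \<le> R * norm u"
      using R by (simp add: mult_right_mono)
    also have "norm c \<le> R * norm c"
      using \<open>R \<ge> 1\<close> by (simp add: mult_le_cancel_right1)
    finally have "R * norm u \<le> R * M"
      by (simp add: M_def algebra_simps)
    then have u: "norm u \<le> M"
      using \<open>R \<ge> 1\<close> by simp
    then have "u \<bullet> u \<le> M\<^sup>2"
      by (simp add: power_mono flip: power2_norm_eq_inner)
    moreover have "\<bar>q \<bullet> u\<bar> \<le> norm q * M"
      using Cauchy_Schwarz_ineq2[of q u] mult_left_mono[OF u, of "norm q"] by simp
    moreover have "R * 1 \<le> R * (R - \<bar>a\<bar> - D)"
      using R \<open>R \<ge> 1\<close> by (intro mult_left_mono) auto
    moreover have "D \<le> R * D" "- (R * \<bar>a\<bar>) \<le> a * R"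
      using \<open>R \<ge> 1\<close> \<open>D \<ge> 0\<close> mult_left_mono[of "- \<bar>a\<bar>" a R]
        mult_right_mono[of 1 R D]
      by (simp_all add: mult.commute)
    ultimately have "g R u \<ge> 0"
      using \<open>R \<ge> 1\<close> by (simp add: g_def D_def power2_eq_square algebra_simps)
    moreover have "continuous_on {r1..R} (\<lambda>r. g r (U r))"
      using r1 by (intro continuous_on_subset[OF cont_g]) auto
    ultimately obtain r where "r1 \<le> r" "g r (U r) = 0"
      using IVT'[of "\<lambda>r. g r (U r)" r1 0 R] r1 R by (auto simp: u_def)
    then show ?thesis
      using r1 by (intro *[OF U]) auto
  next
    case False
    define \<rho> where "\<rho> n = r0 + inverse (real (Suc n))" for n
    \<comment> \<open>An upper bound for \<open>r\<^sup>2 + a * r - e\<close> near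
      \<open>r0\<close>. Once \<open>norm u\<close> exceeds \<open>1 + C + norm q\<close>, the term
      \<open>u \<bullet> u\<close> dominates and \<open>g \<le> 0\<close>, contrary to the case
      assumption.\<close>
    define C where "C = (\<bar>r0\<bar> + 1)\<^sup>2 + \<bar>a\<bar> * (\<bar>r0\<bar> + 1) + \<bar>e\<bar>"
    have \<rho>: "\<rho> n > r0" "\<bar>\<rho> n\<bar> \<le> \<bar>r0\<bar> + 1" for n
    proof -
      have "0 < inverse (real (Suc n))" "inverse (real (Suc n)) \<le> 1"
        by (simp_all add: inverse_le_1_iff)
      then show "\<rho> n > r0" "\<bar>\<rho> n\<bar> \<le> \<bar>r0\<bar> + 1"
        unfolding \<rho>_def by linarith+
    qed
    have "norm (U (\<rho> n)) \<le> 1 + C + norm q" for n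
    proof (rule ccontr)
      define u where "u = U (\<rho> n)"
      assume "\<not> norm (U (\<rho> n)) \<le> 1 + C + norm q"
      moreover have "C \<ge> 0"
        by (simp add: C_def)
      ultimately have u: "norm u \<ge> C + norm q" "norm u \<ge> 1"
        using norm_ge_zero[of q] unfolding u_def by linarith+
      have "C + norm q * norm u \<le> norm u * (C + norm q)"
        using u \<open>C \<ge> 0\<close> by (simp add: algebra_simps mult_le_cancel_left1)
      also have "\<dots> \<le> u \<bullet> u"
        using u by (simp add: mult_left_mono power2_eq_square flip: power2_norm_eq_inner)
      finally have "C + norm q * norm u \<le> u \<bullet> u" .
      moreover have "(\<rho> n)\<^sup>2 \<le> (\<bar>r0\<bar> + 1)\<^sup>2"
        using \<rho>(2)[of n] power_mono[of "\<bar>\<rho> n\<bar>" "\<bar>r0\<bar> + 1" 2] by simp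
      moreover have "a * \<rho> n \<le> \<bar>a\<bar> * (\<bar>r0\<bar> + 1)"
        using \<rho>(2)[of n] by (metis abs_ge_self abs_ge_zero abs_mult mult_left_mono order_trans)
      moreover have "q \<bullet> u \<le> norm q * norm u"
        by (rule norm_cauchy_schwarz)
      ultimately have "g (\<rho> n) u \<le> 0"
        by (simp add: g_def C_def)
      then show False
        using False \<rho>(1) u_def by blast
    qed
    then have "bounded (range (\<lambda>n. U (\<rho> n)))"
      by (auto simp: bounded_iff)
    then obtain u0 \<sigma> where \<sigma>: "strict_mono \<sigma>" "(\<lambda>n. U (\<rho> (\<sigma> n))) \<longlonglongrightarrow> u0"
      using bounded_imp_convergent_subsequence[of "\<lambda>n. U (\<rho> n)"] by (auto simp: o_def)
    have "(\<lambda>n. r0 + inverse (real (Suc n))) \<longlonglongrightarrow> r0 + 0"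
      by (intro tendsto_add tendsto_const LIMSEQ_inverse_real_of_nat)
    then have "\<rho> \<longlonglongrightarrow> r0"
      by (simp only: \<rho>_def[abs_def] add_0_right)
    then have lim: "(\<lambda>n. \<rho> (\<sigma> n)) \<longlonglongrightarrow> r0"
      using LIMSEQ_subseq_LIMSEQ[of \<rho> r0 \<sigma>] \<sigma>(1) by (simp only: o_def)
    have "(\<lambda>n. B (\<rho> (\<sigma> n)) *v U (\<rho> (\<sigma> n))) \<longlonglongrightarrow> B r0 *v u0"
      unfolding B_mult
      by (intro tendsto_intros lim \<sigma> bounded_linear.tendsto[OF matrix_vector_mul_bounded_linear])
    moreover have "(\<lambda>n. B (\<rho> (\<sigma> n)) *v U (\<rho> (\<sigma> n))) \<longlonglongrightarrow> c + r0 *\<^sub>R p"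
      unfolding U[OF \<rho>(1)] by (intro tendsto_intros lim)
    ultimately have u0: "B r0 *v u0 = c + r0 *\<^sub>R p"
      by (rule LIMSEQ_unique)
    have "(\<lambda>n. g (\<rho> (\<sigma> n)) (U (\<rho> (\<sigma> n)))) \<longlonglongrightarrow> g r0 u0"
      unfolding g_def by (intro tendsto_intros lim \<sigma>)
    moreover have "g (\<rho> n) (U (\<rho> n)) \<ge> 0" for n
      using False \<rho>(1)[of n] by (meson linear)
    ultimately have g0: "g r0 u0 \<ge> 0"
      by (intro LIMSEQ_le_const) auto
    obtain k where k: "k \<noteq> 0" "B r0 *v k = 0"
      using r0 det_eq_0_iff_kernel[of "B r0"] by blast
    \<comment> \<open>The linear coefficient of \<open>g r0 (u0 + t *\<^sub>R k)\<close> as a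
      quadratic in \<open>t\<close>. Its leading coefficient is negative and its constant term
      nonnegative, so it has a real root.\<close>
    define b where "b = q \<bullet> k - 2 * (u0 \<bullet> k)"
    have "discrim (- (k \<bullet> k)) b (g r0 u0) \<ge> 0"
      using g0 by (simp add: discrim_def)
    then obtain t where "- (k \<bullet> k) * t\<^sup>2 + b * t + g r0 u0 = 0"
      using discriminant_nonneg_ex[of "- (k \<bullet> k)" b "g r0 u0"] k by auto
    moreover have "g r0 (u0 + t *\<^sub>R k) = - (k \<bullet> k) * t\<^sup>2 + b * t + g r0 u0"
      by (simp add: g_def b_def inner_add_left inner_add_right inner_commute[of k u0]
          power2_eq_square algebra_simps)
    ultimately have "g r0 (u0 + t *\<^sub>R k) = 0"
      by (simp only:)
    moreover have "B r0 *v (u0 + t *\<^sub>R k) = c + r0 *\<^sub>R p"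
      using k u0 by (simp add: matrix_vector_right_distrib matrix_vector_mult_scaleR)
    ultimately show ?thesis
      using * by blast
  qed
qed

section \<open>From quadratic octonion equations to eigenvectors\<close>

text \<open>Only real linearity of \<open>L\<close> is asked for: without associativity, nested
  products with fixed octonions need not collapse to single products.\<close>

lemma octonion_quadratic_solvable:
  fixes L :: "octonion \<Rightarrow> octonion"
  assumes "linear L"
  obtains w where "w * w + L w = e"
proof -
  define A where "A = matrix (\<lambda>u. oct_vec (L (oct_im u)))"
  have lin: "linear (\<lambda>u. oct_vec (L (oct_im u)))" "linear (\<lambda>u. oct_re (L (oct_im u)))"
    using linear_compose[OF linear_compose[OF linear_oct_im assms]] linear_oct_vec linear_oct_re
    by (simp_all add: o_def)
  have A: "A *v u = oct_vec (L (oct_im u))" for u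
    unfolding A_def using lin(1) by simp
  \<comment> \<open>The vector representing the real functional \<open>oct_re (L (oct_im u))\<close>
    as an inner product.\<close>
  define q where "q = adjoint (\<lambda>u. oct_re (L (oct_im u))) 1"
  have q: "q \<bullet> u = oct_re (L (oct_im u))" for u
    using adjoint_works[OF lin(2), of u 1] by (simp add: q_def inner_commute)
  have "odd CARD(7)"
    by simp
  then obtain r u where
    u: "A *v u + (2 * r) *\<^sub>R u = oct_vec e + r *\<^sub>R (- oct_vec (L 1))"
      "r\<^sup>2 - u \<bullet> u + oct_re (L 1) * r + q \<bullet> u = oct_re e"
    by (rule odd_shifted_system_with_quadratic)
  define w where "w = r *\<^sub>R 1 + oct_im u"
  have w: "w * w + L w = (r\<^sup>2 - u \<bullet> u) *\<^sub>R 1 + (2 * r) *\<^sub>R oct_im u + (r *\<^sub>R L 1 + L (oct_im u))"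
    unfolding w_def oct_square using assms by (simp add: linear_add linear_scale)
  have "w * w + L w = e"
  proof (rule oct_eqI)
    show "oct_re (w * w + L w) = oct_re e"
      using u(2) unfolding w q
      by (simp only: linear_add[OF linear_oct_re] linear_scale[OF linear_oct_re]) (simp add: mult.commute)
    show "oct_vec (w * w + L w) = oct_vec e"
      using u(1) unfolding w A
      by (simp only: linear_add[OF linear_oct_vec] linear_scale[OF linear_oct_vec])
        (simp add: algebra_simps)
  qed
  then show thesis by (rule that)
qed

theorem theorem5p1:
  fixes A :: "octonion ^ 2 ^ 2"
  shows "\<exists>l :: octonion. right_eigenvalue A l"
proof (cases "A $ 1 $ 2 = 0")
  case True
  have zero: "0 * x = 0" "x * 0 = 0" for x :: octonion
    using bilinear_lzero[OF bilinear_octonion_times] bilinear_rzero[OF bilinear_octonion_times]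
    by auto
  define v :: "octonion ^ 2" where "v = vector [0, 1]"
  have "v \<noteq> 0"
    by (auto simp: v_def vec_eq_iff forall_2 octonion_defs quat_defs)
  moreover have "oct_matrix_vector_mult A v = oct_vector_scale_right v (A $ 2 $ 2)"
    using True by (simp add: oct_matrix_vector_mult_def oct_vector_scale_right_def vec_eq_iff
        forall_2 v_def zero octonion_one_mult)
  ultimately show ?thesis
    unfolding right_eigenvalue_def by blast
next
  case False
  define a b c d where "a = A $ 1 $ 1" and "b = A $ 1 $ 2" and "c = A $ 2 $ 1" and "d = A $ 2 $ 2"
  define b' where "b' = inverse (octonion_normsq b) *\<^sub>R octonion_cnj b"
  have "octonion_normsq b \<noteq> 0"
    using False by (simp add: b_def octonion_normsq_eq_0_iff)
  then have inv: "b * (b' * x) = x" "b' * (b * x) = x" for x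
    by (simp_all add: b'_def octonion_scaleR_mult octonion_cnj_cancel octonion_cnj_cancel')
  note distrib = bilinear_ladd[OF bilinear_octonion_times] bilinear_radd[OF bilinear_octonion_times]
    bilinear_rsub[OF bilinear_octonion_times]
  \<comment> \<open>The equation \<open>y * (a + b * y) = c + d * y\<close>, with
    \<open>y = b' * w\<close>, is multiplied by \<open>b\<close> from the left.\<close>
  have "linear (\<lambda>w. b * ((b' * w) * a - d * (b' * w)))"
    by (rule linearI) (simp_all add: distrib octonion_scaleR_mult algebra_simps)
  then obtain w where "w * w + b * ((b' * w) * a - d * (b' * w)) = b * c"
    by (rule octonion_quadratic_solvable)
  then have "b' * (w * w + b * ((b' * w) * a - d * (b' * w))) = c"
    by (simp add: inv)
  then have w: "b' * (w * w) + (b' * w) * a - d * (b' * w) = c"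
    by (simp add: distrib inv add_diff_eq)
  define y where "y = b' * w"
  \<comment> \<open>As \<open>b * y = w\<close>, this is the right alternative law
    \<open>(b' * w) * w = b' * (w * w)\<close>.\<close>
  have "b' * (w * w) = y * (b * y)"
    by (simp add: y_def inv octonion_alternative)
  with w have y: "c + d * y = y * (a + b * y)"
    by (simp add: distrib flip: y_def) (simp add: algebra_simps)
  define v :: "octonion ^ 2" where "v = vector [1, y]"
  have "v \<noteq> 0"
    by (auto simp: v_def vec_eq_iff forall_2 octonion_defs quat_defs)
  moreover have "oct_matrix_vector_mult A v = oct_vector_scale_right v (a + b * y)"
    using y by (simp add: oct_matrix_vector_mult_def oct_vector_scale_right_def vec_eq_iff
        forall_2 v_def octonion_one_mult a_def b_def c_def d_def)
  ultimately show ?thesis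
    unfolding right_eigenvalue_def by blast
qed

end
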